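(* Let $\mathcal D$ be any probability distribution on $\mathcal X\times\mathcal Y$, let $\mathbf p\in[0,1]^n$ with $\sum_{i=1}^n p_i=1$, and let $Q=\mathcal C(\mathbf p)$ be the categorical distribution with parameters $\mathbf p$. Put $p_{\mathcal F}=p_{\mathcal F}(\mathbf x,\mathbf y)=\sum_{i=1}^n p_i\,\mathbb 1\{\mathbf f_i(\mathbf x)\ne\mathbf y\}$. Then for all $(\mathbf x,\mathbf y)\in\mathcal X\times\mathcal Y$, $$\mathbb E_{\mathbf w\sim\mathcal C(\mathbf p)}\,\ell(\mathbf h_{\mathbf w}(\mathbf x),\mathbf y)=p_{\mathcal F},$$ and $$b_{\mathcal D}^{\mathcal C(\mathbf p)}(\mathbf h_{\mathbf p})=\mathbb E_{(\mathbf x,\mathbf y)\sim\mathcal D}\big[p_{\mathcal F}\,\big|\,p_{\mathcal F}<0.5\big],\qquad c_{\mathcal D}^{\mathcal C(\mathbf p)}(\mathbf h_{\mathbf p})=\mathbb E_{(\mathbf x,\mathbf y)\sim\mathcal D}\big[p_{\mathcal F}\,\big|\,p_{\mathcal F}\ge0.5\big],$$ each of the latter two whenever the conditioning event has positive probability.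
   Context: $\mathcal Y$ is the set of the one-hot vectors of length $k$ ($k$ classes). $\mathcal F=\{\mathbf f_1,\dots,\mathbf f_n\}$ are fixed base classifiers $\mathbf f_i:\mathcal X\to\mathcal Y$ (measurable). For a weight vector $\mathbf w$, $\mathbf h_{\mathbf w}(\mathbf x)=\sum_{i=1}^n w_i\mathbf f_i(\mathbf x)$ is the weighted majority vote. The loss of a majority vote with nonnegative weights $\mathbf w$ summing to one is $$\ell(\mathbf h_{\mathbf w}(\mathbf x),\mathbf y)=\mathbb 1\Big\{\sum_{i=1}^n w_i\,\mathbb 1\{\mathbf f_i(\mathbf x)\ne\mathbf y\}\ge0.5\Big\}.$$ The categorical distribution $\mathcal C(\mathbf p)$ is the distribution over the standard basis vectors of $\mathbb R^n$ giving probability $p_i$ to the $i$-th basis vector. For a distribution $Q$ on weight vectors, $$b_{\mathcal D}^Q(\mathbf h_{\mathbf p})=\mathbb E_{(\mathbf x,\mathbf y)\sim\mathcal D}\Big[\mathbb E_{\mathbf w\sim Q}\,\ell(\mathbf h_{\mathbf w}(\mathbf x),\mathbf y)\,\Big|\,\ell(\mathbf h_{\mathbf p}(\mathbf x),\mathbf y)=0\Big],\qquad c_{\mathcal D}^Q(\mathbf h_{\mathbf p})=\mathbb E_{(\mathbf x,\mathbf y)\sim\mathcal D}\Big[\mathbb E_{\mathbf w\sim Q}\,\ell(\mathbf h_{\mathbf w}(\mathbf x),\mathbf y)\,\Big|\,\ell(\mathbf h_{\mathbf p}(\mathbf x),\mathbf y)=1\Big].$$ *)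

theory Defs
  imports "HOL-Probability.Probability"
begin

definition one_hot :: "(real ^ 'k) set" where
  "one_hot = range (\<lambda>j. axis j 1)"

definition majority_vote ::
  "('n \<Rightarrow> 'x \<Rightarrow> real ^ 'k) \<Rightarrow> real ^ 'n \<Rightarrow> 'x \<Rightarrow> real ^ 'k" where
  "majority_vote f w x = (\<Sum>i\<in>UNIV. w $ i *\<^sub>R f i x)"

definition weighted_error ::
  "('n \<Rightarrow> 'x \<Rightarrow> real ^ 'k) \<Rightarrow> real ^ 'n \<Rightarrow> 'x \<Rightarrow> real ^ 'k \<Rightarrow> real" where
  "weighted_error f w x y = (\<Sum>i\<in>UNIV. w $ i * of_bool (f i x \<noteq> y))"

(* The loss of the majority vote with weights w. It takes f and w instead of the vector
   majority_vote f w x, since it is defined through the weights of the erring classifiers.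
   By weighted_error_majority_vote below, for weights summing to one and one-hot values it
   depends on f and w only through majority_vote f w x. *)
definition mv_loss ::
  "('n \<Rightarrow> 'x \<Rightarrow> real ^ 'k) \<Rightarrow> real ^ 'n \<Rightarrow> 'x \<Rightarrow> real ^ 'k \<Rightarrow> real" where
  "mv_loss f w x y = of_bool (weighted_error f w x y \<ge> 1 / 2)"

lemma weighted_error_majority_vote:
  fixes f :: "'n::finite \<Rightarrow> 'x \<Rightarrow> real ^ 'k"
  assumes "(\<Sum>i\<in>UNIV. w $ i) = 1" "\<And>i. f i x \<in> one_hot" "y \<in> one_hot"
  shows "weighted_error f w x y = 1 - majority_vote f w x \<bullet> y"
proof -
  have "f i x \<bullet> y = 1 - of_bool (f i x \<noteq> y)" for i
    using assms(2)[of i] assms(3)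
    by (auto simp: one_hot_def inner_axis_axis axis_eq_axis)
  then show ?thesis
    by (simp add: weighted_error_def majority_vote_def inner_sum_left right_diff_distrib
        sum_subtractf assms(1))
qed

(* Meaningful only for p in the probability simplex; see pmf_categorical. *)
definition categorical :: "real ^ 'n \<Rightarrow> (real ^ 'n) pmf" where
  "categorical p = map_pmf (\<lambda>i. axis i 1) (embed_pmf (\<lambda>i. p $ i))"

lemma pmf_categorical:
  fixes p :: "real ^ 'n"
  assumes "\<And>i. p $ i \<ge> 0" "(\<Sum>i\<in>UNIV. p $ i) = 1"
  shows "pmf (categorical p) (axis i 1) = p $ i"
proof -
  have "inj (\<lambda>i::'n. axis i (1::real))"
    by (auto simp: inj_def axis_eq_axis)
  moreover have "(\<integral>\<^sup>+ i. ennreal (p $ i) \<partial>count_space UNIV) = 1"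
    using assms by (simp add: nn_integral_count_space_finite)
  ultimately show ?thesis
    using assms pmf_map_inj'[of "\<lambda>i::'n. axis i (1::real)" "embed_pmf (\<lambda>i. p $ i)" i]
    by (simp add: categorical_def pmf_embed_pmf)
qed

(* Expectation conditional on an event of positive probability. *)
definition cond_expectation :: "'a measure \<Rightarrow> ('a \<Rightarrow> real) \<Rightarrow> ('a \<Rightarrow> bool) \<Rightarrow> real" where
  "cond_expectation M Z P = integral\<^sup>L (uniform_measure M {z \<in> space M. P z}) Z"

definition cond_loss_correct ::
  "('x \<times> (real ^ 'k)) measure \<Rightarrow> ('n \<Rightarrow> 'x \<Rightarrow> real ^ 'k) \<Rightarrow> (real ^ 'n) measure \<Rightarrow> real ^ 'n \<Rightarrow> real"
  where
  "cond_loss_correct D f Q p =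
     cond_expectation D (\<lambda>(x, y). \<integral>w. mv_loss f w x y \<partial>Q) (\<lambda>(x, y). mv_loss f p x y = 0)"

definition cond_loss_wrong ::
  "('x \<times> (real ^ 'k)) measure \<Rightarrow> ('n \<Rightarrow> 'x \<Rightarrow> real ^ 'k) \<Rightarrow> (real ^ 'n) measure \<Rightarrow> real ^ 'n \<Rightarrow> real"
  where
  "cond_loss_wrong D f Q p =
     cond_expectation D (\<lambda>(x, y). \<integral>w. mv_loss f w x y \<partial>Q) (\<lambda>(x, y). mv_loss f p x y = 1)"

end

theory Submission
  imports Defs
begin

text \<open>A draw from \<open>categorical p\<close> is a basis vector \<open>axis i 1\<close>, and
  it puts all the weight on the single classifier \<open>f i\<close>. Its loss is therefore the
  error indicator of \<open>f i\<close>, and averaging with the probabilities \<open>p $ i\<close>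
  gives \<open>weighted_error f p x y\<close> (\<open>expectation_mv_loss_categorical\<close>).
  Moreover, the loss of \<open>p\<close> itself is the indicator that this same quantity is at least
  1/2. So in both conditional expectations the integrand and the conditioning event can be rewritten
  pointwise in terms of the weighted error.\<close>

lemma mv_loss_axis:
  fixes f :: "'n::finite \<Rightarrow> 'x \<Rightarrow> real ^ 'k"
  shows "mv_loss f (axis i 1) x y = of_bool (f i x \<noteq> y)"
proof -
  \<comment> \<open>Only the term \<open>j = i\<close> survives, so the weighted error is 0 or 1,
    and comparing it with 1/2 returns it unchanged.\<close>
  have "weighted_error f (axis i 1) x y = (\<Sum>j\<in>UNIV. if j = i then of_bool (f j x \<noteq> y) else 0)"
    unfolding weighted_error_def by (rule sum.cong) (auto simp: axis_def)
  then show ?thesis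
    by (simp add: mv_loss_def)
qed

lemma expectation_categorical:
  fixes p :: "real ^ 'n" and g :: "real ^ 'n \<Rightarrow> real"
  assumes "\<And>i. p $ i \<ge> 0" "(\<Sum>i\<in>UNIV. p $ i) = 1"
  shows "measure_pmf.expectation (categorical p) g = (\<Sum>i\<in>UNIV. p $ i * g (axis i 1))"
proof -
  \<comment> \<open>Total mass 1, together with nonnegativity, is what lets \<open>embed_pmf\<close>
    have \<open>p\<close> as its mass function.\<close>
  have "(\<integral>\<^sup>+ i. ennreal (p $ i) \<partial>count_space UNIV) = 1"
    using assms by (simp add: nn_integral_count_space_finite)
  then have "pmf (embed_pmf (\<lambda>i. p $ i)) i = p $ i" for i
    using assms by (simp add: pmf_embed_pmf)
  then show ?thesis
    \<comment> \<open>The expectation is pulled back along \<open>axis\<close> to the finite index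
      type, where it is a finite sum.\<close>
    by (simp add: categorical_def integral_measure_pmf_real[where A = UNIV] mult.commute)
qed

lemma expectation_mv_loss_categorical:
  fixes f :: "'n::finite \<Rightarrow> 'x \<Rightarrow> real ^ 'k"
  assumes "\<And>i. p $ i \<ge> 0" "(\<Sum>i\<in>UNIV. p $ i) = 1"
  shows "measure_pmf.expectation (categorical p) (\<lambda>w. mv_loss f w x y) = weighted_error f p x y"
  by (simp add: expectation_categorical[OF assms] mv_loss_axis weighted_error_def)

theorem proposition2:
  fixes X :: "'x measure"
    and D :: "('x \<times> (real ^ 'k)) measure"
    and f :: "'n::finite \<Rightarrow> 'x \<Rightarrow> real ^ 'k"
    and p :: "real ^ 'n"
  assumes f: "\<And>i. f i \<in> X \<rightarrow>\<^sub>M count_space one_hot"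
    and D: "prob_space D" "sets D = sets (X \<Otimes>\<^sub>M count_space one_hot)"
    and p: "\<And>i. p $ i \<in> {0..1}" "(\<Sum>i\<in>UNIV. p $ i) = 1"
  shows "(\<forall>x\<in>space X. \<forall>y\<in>one_hot.
            measure_pmf.expectation (categorical p) (\<lambda>w. mv_loss f w x y) = weighted_error f p x y)
       \<and> (measure D {z \<in> space D. case z of (x, y) \<Rightarrow> mv_loss f p x y = 0} > 0 \<longrightarrow>
            cond_loss_correct D f (measure_pmf (categorical p)) p =
              cond_expectation D (\<lambda>(x, y). weighted_error f p x y)
                (\<lambda>(x, y). weighted_error f p x y < 1 / 2))
       \<and> (measure D {z \<in> space D. case z of (x, y) \<Rightarrow> mv_loss f p x y = 1} > 0 \<longrightarrow>
            cond_loss_wrong D f (measure_pmf (categorical p)) p =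
              cond_expectation D (\<lambda>(x, y). weighted_error f p x y)
                (\<lambda>(x, y). weighted_error f p x y \<ge> 1 / 2))"
proof -
  have "measure_pmf.expectation (categorical p) (\<lambda>w. mv_loss f w x y) = weighted_error f p x y"
    for x y
    using p by (intro expectation_mv_loss_categorical) auto
  \<comment> \<open>The loss takes only the values 0 and 1, so its two level sets are the two sides
    of the threshold; a tie at 1/2 counts as an error.\<close>
  moreover have "mv_loss f p x y = 0 \<longleftrightarrow> weighted_error f p x y < 1 / 2"
    "mv_loss f p x y = 1 \<longleftrightarrow> weighted_error f p x y \<ge> 1 / 2" for x y
    by (auto simp: mv_loss_def)
  ultimately show ?thesis
    by (simp add: cond_loss_correct_def cond_loss_wrong_def)
qed

end
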